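(* Let $\Gamma$ be a finitely generated group with the property that for every finite subset $F\subset\Gamma$ there is a cocycle $\psi\in\mathcal{Z}^2(\Gamma,\mathbb{Z})$ (trivial action on $\mathbb{Z}$) that is not a coboundary and satisfies $\psi|_{F\times F}=0$. Identify $\mathbb{Z}^m$ with $\mathbb{Z}^m\oplus\{0\}\subseteq\mathbb{Z}^n$ whenever $m\le n$, and similarly with initial-coordinate subgroups of $\mathbb{Z}^{\oplus\infty}$ (the countable direct sum). Let $A_n:=\mathbb{Z}^n$, so that $A_1\subset A_2\subset\cdots$ is an increasing sequence of discrete Abelian groups with direct limit $A:=\mathbb{Z}^{\oplus\infty}$, and let $\Gamma$ act trivially on $A$. Then the direct limit of the homomorphisms induced by inclusion, $$\lim_{m\to}\mathrm{H}^2(\Gamma,A_m)\longrightarrow\mathrm{H}^2(\Gamma,A),$$ is not surjective.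
   Context: $\Gamma$ is a discrete group, and $\mathrm{H}^\ast(\Gamma,\cdot)$ is ordinary group cohomology, computed with inhomogeneous cochains: $\mathcal{Z}^2(\Gamma,A)$ is the group of functions $\psi:\Gamma^2\to A$ with $\psi(g_2,g_3)-\psi(g_1g_2,g_3)+\psi(g_1,g_2g_3)-\psi(g_1,g_2)=0$ (trivial action), and coboundaries are the functions $(g_1,g_2)\mapsto\phi(g_2)-\phi(g_1g_2)+\phi(g_1)$. *)

theory Defs
  imports "HOL-Algebra.Free_Abelian_Groups"
begin

text \<open>Second cohomology of a group \<open>G\<close> with coefficients in an abelian group \<open>A\<close> on which
  \<open>G\<close> acts trivially.  The coefficient group is written multiplicatively; cochains are extensional
  functions on \<open>carrier G \<times> carrier G\<close>.\<close>

definition cochains2 :: "('g, 'u) monoid_scheme \<Rightarrow> ('a, 'v) monoid_scheme \<Rightarrow> ('g \<times> 'g \<Rightarrow> 'a) monoid"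
  where "cochains2 G A = product_group (carrier G \<times> carrier G) (\<lambda>_. A)"

definition cocycles2 :: "('g, 'u) monoid_scheme \<Rightarrow> ('a, 'v) monoid_scheme \<Rightarrow> ('g \<times> 'g \<Rightarrow> 'a) set"
  where "cocycles2 G A = {\<psi> \<in> carrier (cochains2 G A).
    \<forall>g1\<in>carrier G. \<forall>g2\<in>carrier G. \<forall>g3\<in>carrier G.
      \<psi> (g2, g3) \<otimes>\<^bsub>A\<^esub> inv\<^bsub>A\<^esub> \<psi> (g1 \<otimes>\<^bsub>G\<^esub> g2, g3) \<otimes>\<^bsub>A\<^esub> \<psi> (g1, g2 \<otimes>\<^bsub>G\<^esub> g3) \<otimes>\<^bsub>A\<^esub> inv\<^bsub>A\<^esub> \<psi> (g1, g2) = \<one>\<^bsub>A\<^esub>}"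

definition coboundary1 ::
    "('g, 'u) monoid_scheme \<Rightarrow> ('a, 'v) monoid_scheme \<Rightarrow> ('g \<Rightarrow> 'a) \<Rightarrow> 'g \<times> 'g \<Rightarrow> 'a"
  where "coboundary1 G A \<phi> =
    (\<lambda>(g1, g2)\<in>carrier G \<times> carrier G. \<phi> g2 \<otimes>\<^bsub>A\<^esub> inv\<^bsub>A\<^esub> \<phi> (g1 \<otimes>\<^bsub>G\<^esub> g2) \<otimes>\<^bsub>A\<^esub> \<phi> g1)"

definition coboundaries2 :: "('g, 'u) monoid_scheme \<Rightarrow> ('a, 'v) monoid_scheme \<Rightarrow> ('g \<times> 'g \<Rightarrow> 'a) set"
  where "coboundaries2 G A = coboundary1 G A ` (carrier G \<rightarrow>\<^sub>E carrier A)"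

abbreviation cocycle_group2 ::
    "('g, 'u) monoid_scheme \<Rightarrow> ('a, 'v) monoid_scheme \<Rightarrow> ('g \<times> 'g \<Rightarrow> 'a) monoid"
  where "cocycle_group2 G A \<equiv> (cochains2 G A)\<lparr>carrier := cocycles2 G A\<rparr>"

definition H2 :: "('g, 'u) monoid_scheme \<Rightarrow> ('a, 'v) monoid_scheme \<Rightarrow> ('g \<times> 'g \<Rightarrow> 'a) set monoid"
  where "H2 G A = cocycle_group2 G A Mod coboundaries2 G A"

definition class2 ::
    "('g, 'u) monoid_scheme \<Rightarrow> ('a, 'v) monoid_scheme \<Rightarrow> ('g \<times> 'g \<Rightarrow> 'a) \<Rightarrow> ('g \<times> 'g \<Rightarrow> 'a) set"
  where "class2 G A \<psi> = coboundaries2 G A #>\<^bsub>cocycle_group2 G A\<^esub> \<psi>"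

definition push2 :: "('g, 'u) monoid_scheme \<Rightarrow> ('a \<Rightarrow> 'b) \<Rightarrow> ('g \<times> 'g \<Rightarrow> 'a) \<Rightarrow> 'g \<times> 'g \<Rightarrow> 'b"
  where "push2 G h \<psi> = (\<lambda>p\<in>carrier G \<times> carrier G. h (\<psi> p))"

text \<open>The homomorphism induced by a homomorphism \<open>h\<close> into \<open>B\<close>: the class of \<open>\<psi>\<close> is sent to the
  class of \<open>h \<circ> \<psi>\<close>.  Independence of the representative is \<open>H2_map_class2\<close> below.\<close>

definition H2_map :: "('g, 'u) monoid_scheme \<Rightarrow> ('b, 'v) monoid_scheme \<Rightarrow> ('a \<Rightarrow> 'b) \<Rightarrow>
    ('g \<times> 'g \<Rightarrow> 'a) set \<Rightarrow> ('g \<times> 'g \<Rightarrow> 'b) set"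
  where "H2_map G B h X = the_elem ((\<lambda>\<psi>. class2 G B (push2 G h \<psi>)) ` X)"

text \<open>The direct limit of groups \<open>D i\<close>, \<open>i \<in> I\<close>, along transition maps \<open>f i j : D i \<rightarrow> D j\<close>,
  \<open>i \<le> j\<close>: the disjoint union of the carriers modulo eventual equality.\<close>

definition dlim_rel :: "'i::order set \<Rightarrow> ('i \<Rightarrow> ('d, 'u) monoid_scheme) \<Rightarrow> ('i \<Rightarrow> 'i \<Rightarrow> 'd \<Rightarrow> 'd) \<Rightarrow>
    (('i \<times> 'd) \<times> ('i \<times> 'd)) set"
  where "dlim_rel I D f = {((i, x), (j, y)).
    i \<in> I \<and> x \<in> carrier (D i) \<and> j \<in> I \<and> y \<in> carrier (D j) \<and>
    (\<exists>k\<in>I. i \<le> k \<and> j \<le> k \<and> f i k x = f j k y)}"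

definition dlim :: "'i::order set \<Rightarrow> ('i \<Rightarrow> ('d, 'u) monoid_scheme) \<Rightarrow> ('i \<Rightarrow> 'i \<Rightarrow> 'd \<Rightarrow> 'd) \<Rightarrow>
    ('i \<times> 'd) set monoid"
  where "dlim I D f =
    \<lparr>carrier = (SIGMA i:I. carrier (D i)) // dlim_rel I D f,
     monoid.mult = (\<lambda>X Y. \<Union>(i, x)\<in>X. \<Union>(j, y)\<in>Y. \<Union>k\<in>{k\<in>I. i \<le> k \<and> j \<le> k}.
       dlim_rel I D f `` {(k, f i k x \<otimes>\<^bsub>D k\<^esub> f j k y)}),
     one = (\<Union>i\<in>I. dlim_rel I D f `` {(i, \<one>\<^bsub>D i\<^esub>)})\<rparr>"

text \<open>The homomorphism out of the direct limit determined by a compatible family of homomorphisms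
  \<open>h i\<close> out of the groups \<open>D i\<close>.\<close>

definition dlim_map :: "('i \<Rightarrow> 'd \<Rightarrow> 'e) \<Rightarrow> ('i \<times> 'd) set \<Rightarrow> 'e"
  where "dlim_map h X = the_elem ((\<lambda>(i, x). h i x) ` X)"

text \<open>\<open>ZZ n\<close> is the group of finitely supported integer sequences whose coordinates with
  index at least \<open>n\<close> vanish, so that \<open>ZZ m \<subseteq> ZZ n\<close> for \<open>m \<le> n\<close> realises the identification
  of the free abelian group of rank \<open>m\<close> with an initial-coordinate subgroup;
  \<open>ZZ_inf\<close> is the union.\<close>

abbreviation ZZ :: "nat \<Rightarrow> (nat \<Rightarrow>\<^sub>0 int) monoid"
  where "ZZ n \<equiv> free_Abelian_group {..<n}"

abbreviation ZZ_inf :: "(nat \<Rightarrow>\<^sub>0 int) monoid"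
  where "ZZ_inf \<equiv> free_Abelian_group UNIV"

abbreviation H2_ZZ_dlim ::
    "('g, 'u) monoid_scheme \<Rightarrow> (nat \<times> ('g \<times> 'g \<Rightarrow> (nat \<Rightarrow>\<^sub>0 int)) set) set monoid"
  where "H2_ZZ_dlim G \<equiv> dlim {1..} (\<lambda>m. H2 G (ZZ m)) (\<lambda>m n. H2_map G (ZZ n) (\<lambda>x. x))"

abbreviation H2_ZZ_dlim_map ::
    "('g, 'u) monoid_scheme \<Rightarrow> (nat \<times> ('g \<times> 'g \<Rightarrow> (nat \<Rightarrow>\<^sub>0 int)) set) set \<Rightarrow>
     ('g \<times> 'g \<Rightarrow> (nat \<Rightarrow>\<^sub>0 int)) set"
  where "H2_ZZ_dlim_map G \<equiv> dlim_map (\<lambda>m. H2_map G ZZ_inf (\<lambda>x. x))"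


subsection \<open>Well-definedness\<close>

lemma push2_cochain:
  assumes "h \<in> hom A B" "\<psi> \<in> carrier (cochains2 G A)"
  shows "push2 G h \<psi> \<in> carrier (cochains2 G B)"
  using assms by (auto simp: cochains2_def push2_def hom_def Pi_iff PiE_iff)

locale trivial_coeff = G: group G + A: comm_group A
  for G :: "('g, 'u) monoid_scheme" (structure) and A :: "('a, 'v) monoid_scheme"
begin

lemma comm_group_cochains2: "comm_group (cochains2 G A)"
  by (rule group.group_comm_groupI)
     (auto simp: cochains2_def A.m_comm PiE_iff intro!: restrict_ext)

lemma coboundary1_in:
  assumes "\<phi> \<in> carrier G \<rightarrow>\<^sub>E carrier A"
  shows "coboundary1 G A \<phi> \<in> cocycles2 G A"
proof -
  have *: "\<phi> g \<in> carrier A" if "g \<in> carrier G" for g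
    using assms that by auto
  have cancel: "(c \<otimes>\<^bsub>A\<^esub> inv\<^bsub>A\<^esub> bc \<otimes>\<^bsub>A\<^esub> b) \<otimes>\<^bsub>A\<^esub> inv\<^bsub>A\<^esub> (c \<otimes>\<^bsub>A\<^esub> inv\<^bsub>A\<^esub> abc \<otimes>\<^bsub>A\<^esub> ab)
      \<otimes>\<^bsub>A\<^esub> (bc \<otimes>\<^bsub>A\<^esub> inv\<^bsub>A\<^esub> abc \<otimes>\<^bsub>A\<^esub> a) \<otimes>\<^bsub>A\<^esub> inv\<^bsub>A\<^esub> (b \<otimes>\<^bsub>A\<^esub> inv\<^bsub>A\<^esub> ab \<otimes>\<^bsub>A\<^esub> a) = \<one>\<^bsub>A\<^esub>"
    if "a \<in> carrier A" "b \<in> carrier A" "c \<in> carrier A" "ab \<in> carrier A" "bc \<in> carrier A"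
      "abc \<in> carrier A" for a b c ab bc abc
  proof -
    have "(c \<otimes>\<^bsub>A\<^esub> bc' \<otimes>\<^bsub>A\<^esub> b) \<otimes>\<^bsub>A\<^esub> (c' \<otimes>\<^bsub>A\<^esub> abc \<otimes>\<^bsub>A\<^esub> ab') \<otimes>\<^bsub>A\<^esub> (bc \<otimes>\<^bsub>A\<^esub> abc' \<otimes>\<^bsub>A\<^esub> a) \<otimes>\<^bsub>A\<^esub> (b' \<otimes>\<^bsub>A\<^esub> ab \<otimes>\<^bsub>A\<^esub> a')
        = (c \<otimes>\<^bsub>A\<^esub> c') \<otimes>\<^bsub>A\<^esub> (bc \<otimes>\<^bsub>A\<^esub> bc') \<otimes>\<^bsub>A\<^esub> (b \<otimes>\<^bsub>A\<^esub> b') \<otimes>\<^bsub>A\<^esub> (abc \<otimes>\<^bsub>A\<^esub> abc') \<otimes>\<^bsub>A\<^esub> (ab \<otimes>\<^bsub>A\<^esub> ab') \<otimes>\<^bsub>A\<^esub> (a \<otimes>\<^bsub>A\<^esub> a')"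
      if "a' \<in> carrier A" "b' \<in> carrier A" "c' \<in> carrier A" "ab' \<in> carrier A" "bc' \<in> carrier A"
        "abc' \<in> carrier A" for a' b' c' ab' bc' abc'
      using that \<open>a \<in> _\<close> \<open>b \<in> _\<close> \<open>c \<in> _\<close> \<open>ab \<in> _\<close> \<open>bc \<in> _\<close> \<open>abc \<in> _\<close>
      by (simp add: A.m_ac)
    from this[of "inv\<^bsub>A\<^esub> a" "inv\<^bsub>A\<^esub> b" "inv\<^bsub>A\<^esub> c" "inv\<^bsub>A\<^esub> ab" "inv\<^bsub>A\<^esub> bc" "inv\<^bsub>A\<^esub> abc"]
    show ?thesis
      using that by (simp add: A.inv_mult)
  qed
  show ?thesis
    unfolding cocycles2_def
    using cancel
    by (auto simp: cochains2_def coboundary1_def * G.m_assoc)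
qed

lemma subgroup_cocycles2: "subgroup (cocycles2 G A) (cochains2 G A)"
proof -
  interpret C: comm_group "cochains2 G A" by (rule comm_group_cochains2)
  show ?thesis
  proof (rule C.subgroupI)
    show "cocycles2 G A \<subseteq> carrier (cochains2 G A)"
      by (auto simp: cocycles2_def)
    have "\<one>\<^bsub>cochains2 G A\<^esub> \<in> cocycles2 G A"
      by (auto simp: cocycles2_def cochains2_def)
    then show "cocycles2 G A \<noteq> {}" by blast
  next
    fix \<psi> assume \<psi>: "\<psi> \<in> cocycles2 G A"
    then have c: "\<psi> p \<in> carrier A" if "p \<in> carrier G \<times> carrier G" for p
      using that by (auto simp: cocycles2_def cochains2_def)
    have i: "inv\<^bsub>cochains2 G A\<^esub> \<psi> = (\<lambda>p\<in>carrier G \<times> carrier G. inv\<^bsub>A\<^esub> \<psi> p)"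
      using \<psi> by (auto simp: cocycles2_def cochains2_def)
    have flip: "inv\<^bsub>A\<^esub> a \<otimes>\<^bsub>A\<^esub> inv\<^bsub>A\<^esub> (inv\<^bsub>A\<^esub> b) \<otimes>\<^bsub>A\<^esub> inv\<^bsub>A\<^esub> c \<otimes>\<^bsub>A\<^esub> inv\<^bsub>A\<^esub> (inv\<^bsub>A\<^esub> d) = \<one>\<^bsub>A\<^esub>"
      if "a \<otimes>\<^bsub>A\<^esub> inv\<^bsub>A\<^esub> b \<otimes>\<^bsub>A\<^esub> c \<otimes>\<^bsub>A\<^esub> inv\<^bsub>A\<^esub> d = \<one>\<^bsub>A\<^esub>"
        "a \<in> carrier A" "b \<in> carrier A" "c \<in> carrier A" "d \<in> carrier A" for a b c d
    proof -
      have "inv\<^bsub>A\<^esub> (a \<otimes>\<^bsub>A\<^esub> inv\<^bsub>A\<^esub> b \<otimes>\<^bsub>A\<^esub> c \<otimes>\<^bsub>A\<^esub> inv\<^bsub>A\<^esub> d) = \<one>\<^bsub>A\<^esub>" using that(1) by simp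
      then show ?thesis using that(2-) by (simp add: A.inv_mult)
    qed
    show "inv\<^bsub>cochains2 G A\<^esub> \<psi> \<in> cocycles2 G A"
      unfolding i using \<psi> flip c by (simp add: cocycles2_def cochains2_def)
  next
    fix \<psi> \<chi> assume h: "\<psi> \<in> cocycles2 G A" "\<chi> \<in> cocycles2 G A"
    then have c: "\<psi> p \<in> carrier A" "\<chi> p \<in> carrier A" if "p \<in> carrier G \<times> carrier G" for p
      using that by (auto simp: cocycles2_def cochains2_def)
    have add: "(a \<otimes>\<^bsub>A\<^esub> a') \<otimes>\<^bsub>A\<^esub> inv\<^bsub>A\<^esub> (b \<otimes>\<^bsub>A\<^esub> b') \<otimes>\<^bsub>A\<^esub> (c \<otimes>\<^bsub>A\<^esub> c') \<otimes>\<^bsub>A\<^esub> inv\<^bsub>A\<^esub> (d \<otimes>\<^bsub>A\<^esub> d') = \<one>\<^bsub>A\<^esub>"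
      if "a \<otimes>\<^bsub>A\<^esub> inv\<^bsub>A\<^esub> b \<otimes>\<^bsub>A\<^esub> c \<otimes>\<^bsub>A\<^esub> inv\<^bsub>A\<^esub> d = \<one>\<^bsub>A\<^esub>" "a' \<otimes>\<^bsub>A\<^esub> inv\<^bsub>A\<^esub> b' \<otimes>\<^bsub>A\<^esub> c' \<otimes>\<^bsub>A\<^esub> inv\<^bsub>A\<^esub> d' = \<one>\<^bsub>A\<^esub>"
        "a \<in> carrier A" "b \<in> carrier A" "c \<in> carrier A" "d \<in> carrier A"
        "a' \<in> carrier A" "b' \<in> carrier A" "c' \<in> carrier A" "d' \<in> carrier A"
      for a b c d a' b' c' d'
    proof -
      have "(a \<otimes>\<^bsub>A\<^esub> a') \<otimes>\<^bsub>A\<^esub> inv\<^bsub>A\<^esub> (b \<otimes>\<^bsub>A\<^esub> b') \<otimes>\<^bsub>A\<^esub> (c \<otimes>\<^bsub>A\<^esub> c') \<otimes>\<^bsub>A\<^esub> inv\<^bsub>A\<^esub> (d \<otimes>\<^bsub>A\<^esub> d')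
        = (a \<otimes>\<^bsub>A\<^esub> inv\<^bsub>A\<^esub> b \<otimes>\<^bsub>A\<^esub> c \<otimes>\<^bsub>A\<^esub> inv\<^bsub>A\<^esub> d) \<otimes>\<^bsub>A\<^esub> (a' \<otimes>\<^bsub>A\<^esub> inv\<^bsub>A\<^esub> b' \<otimes>\<^bsub>A\<^esub> c' \<otimes>\<^bsub>A\<^esub> inv\<^bsub>A\<^esub> d')"
        using that(3-) by (simp add: A.inv_mult A.m_ac)
      then show ?thesis using that(1,2) by simp
    qed
    show "\<psi> \<otimes>\<^bsub>cochains2 G A\<^esub> \<chi> \<in> cocycles2 G A"
      using h add c by (simp add: cocycles2_def cochains2_def)
  qed
qed

lemma comm_group_cocycle_group2: "comm_group (cocycle_group2 G A)"
proof -
  interpret C: comm_group "cochains2 G A" by (rule comm_group_cochains2)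
  interpret Z: subgroup "cocycles2 G A" "cochains2 G A" by (rule subgroup_cocycles2)
  have "group (cocycle_group2 G A)"
    by (rule C.subgroup_imp_group[OF subgroup_cocycles2])
  then show ?thesis
    by (rule group.group_comm_groupI) (simp add: C.m_comm)
qed

lemma subgroup_coboundaries2: "subgroup (coboundaries2 G A) (cocycle_group2 G A)"
proof -
  interpret P: group "product_group (carrier G) (\<lambda>_. A)" by simp
  interpret C: comm_group "cocycle_group2 G A" by (rule comm_group_cocycle_group2)
  have "coboundary1 G A \<in> hom (product_group (carrier G) (\<lambda>_. A)) (cocycle_group2 G A)"
  proof (rule homI)
    fix x y assume xy: "x \<in> carrier (product_group (carrier G) (\<lambda>_. A))"
      "y \<in> carrier (product_group (carrier G) (\<lambda>_. A))"
    then have "x g \<in> carrier A" "y g \<in> carrier A" if "g \<in> carrier G" for g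
      using that by auto
    then show "coboundary1 G A (x \<otimes>\<^bsub>product_group (carrier G) (\<lambda>_. A)\<^esub> y)
        = coboundary1 G A x \<otimes>\<^bsub>cocycle_group2 G A\<^esub> coboundary1 G A y"
      by (auto simp: coboundary1_def cochains2_def fun_eq_iff A.inv_mult A.m_ac)
  qed (use coboundary1_in in simp)
  then interpret h: group_hom "product_group (carrier G) (\<lambda>_. A)" "cocycle_group2 G A" "coboundary1 G A"
    by unfold_locales
  show ?thesis
    using h.img_is_subgroup by (simp add: coboundaries2_def)
qed

lemma normal_coboundaries2: "coboundaries2 G A \<lhd> cocycle_group2 G A"
  by (rule comm_group.subgroup_imp_normal[OF comm_group_cocycle_group2 subgroup_coboundaries2])

lemma comm_group_H2: "comm_group (H2 G A)"
  unfolding H2_def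
  by (rule comm_group.abelian_FactGroup[OF comm_group_cocycle_group2 subgroup_coboundaries2])

end

locale coeff_hom = A: trivial_coeff G A + B: trivial_coeff G B
  for G :: "('g, 'u) monoid_scheme" (structure)
    and A :: "('a, 'v) monoid_scheme" and B :: "('b, 'w) monoid_scheme" +
  fixes h assumes hom: "h \<in> hom A B"
begin

sublocale hm: group_hom A B h
  by unfold_locales (rule hom)

lemma push2_hom: "push2 G h \<in> hom (cocycle_group2 G A) (cocycle_group2 G B)"
proof (rule homI)
  fix \<psi> assume \<psi>: "\<psi> \<in> carrier (cocycle_group2 G A)"
  then have c: "\<psi> p \<in> carrier A" if "p \<in> carrier G \<times> carrier G" for p
    using that by (auto simp: cocycles2_def cochains2_def)
  have *: "h a \<otimes>\<^bsub>B\<^esub> inv\<^bsub>B\<^esub> h b \<otimes>\<^bsub>B\<^esub> h c \<otimes>\<^bsub>B\<^esub> inv\<^bsub>B\<^esub> h d = \<one>\<^bsub>B\<^esub>"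
    if "a \<otimes>\<^bsub>A\<^esub> inv\<^bsub>A\<^esub> b \<otimes>\<^bsub>A\<^esub> c \<otimes>\<^bsub>A\<^esub> inv\<^bsub>A\<^esub> d = \<one>\<^bsub>A\<^esub>"
      "a \<in> carrier A" "b \<in> carrier A" "c \<in> carrier A" "d \<in> carrier A" for a b c d
  proof -
    have "h (a \<otimes>\<^bsub>A\<^esub> inv\<^bsub>A\<^esub> b \<otimes>\<^bsub>A\<^esub> c \<otimes>\<^bsub>A\<^esub> inv\<^bsub>A\<^esub> d) = \<one>\<^bsub>B\<^esub>" using that(1) by simp
    then show ?thesis using that(2-) by simp
  qed
  show "push2 G h \<psi> \<in> carrier (cocycle_group2 G B)"
    using \<psi> * c push2_cochain[OF hom, of \<psi> G]
    by (simp add: cocycles2_def) (simp add: push2_def)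
next
  fix \<psi> \<chi> assume h: "\<psi> \<in> carrier (cocycle_group2 G A)" "\<chi> \<in> carrier (cocycle_group2 G A)"
  then have c: "\<psi> p \<in> carrier A" "\<chi> p \<in> carrier A" if "p \<in> carrier G \<times> carrier G" for p
    using that by (auto simp: cocycles2_def cochains2_def)
  then show "push2 G h (\<psi> \<otimes>\<^bsub>cocycle_group2 G A\<^esub> \<chi>)
      = push2 G h \<psi> \<otimes>\<^bsub>cocycle_group2 G B\<^esub> push2 G h \<chi>"
    by (auto simp: push2_def cochains2_def fun_eq_iff)
qed

lemma push2_coboundary:
  assumes "b \<in> coboundaries2 G A"
  shows "push2 G h b \<in> coboundaries2 G B"
proof -
  obtain \<phi> where \<phi>: "\<phi> \<in> carrier G \<rightarrow>\<^sub>E carrier A" "b = coboundary1 G A \<phi>"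
    using assms by (auto simp: coboundaries2_def)
  then have "\<phi> g \<in> carrier A" if "g \<in> carrier G" for g
    using that by auto
  then have "push2 G h b = coboundary1 G B (\<lambda>g\<in>carrier G. h (\<phi> g))"
    by (auto simp: \<phi>(2) push2_def coboundary1_def fun_eq_iff)
  moreover have "(\<lambda>g\<in>carrier G. h (\<phi> g)) \<in> carrier G \<rightarrow>\<^sub>E carrier B"
    using \<phi>(1) by (auto intro!: hm.hom_closed)
  ultimately show ?thesis by (auto simp: coboundaries2_def)
qed

lemma H2_map_class2:
  assumes "\<psi> \<in> cocycles2 G A"
  shows "H2_map G B h (class2 G A \<psi>) = class2 G B (push2 G h \<psi>)"
proof -
  interpret ZA: comm_group "cocycle_group2 G A" by (rule A.comm_group_cocycle_group2)
  interpret ZB: comm_group "cocycle_group2 G B" by (rule B.comm_group_cocycle_group2)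
  interpret BA: subgroup "coboundaries2 G A" "cocycle_group2 G A" by (rule A.subgroup_coboundaries2)
  interpret BB: subgroup "coboundaries2 G B" "cocycle_group2 G B" by (rule B.subgroup_coboundaries2)
  interpret p: group_hom "cocycle_group2 G A" "cocycle_group2 G B" "push2 G h"
    by unfold_locales (rule push2_hom)
  have "class2 G B (push2 G h \<chi>) = class2 G B (push2 G h \<psi>)"
    if "\<chi> \<in> class2 G A \<psi>" for \<chi>
  proof -
    obtain b where b: "b \<in> coboundaries2 G A" "\<chi> = b \<otimes>\<^bsub>cocycle_group2 G A\<^esub> \<psi>"
      using \<open>\<chi> \<in> _\<close> unfolding class2_def r_coset_def by blast
    have bc: "b \<in> carrier (cocycle_group2 G A)" using b(1) by (rule BA.mem_carrier)
    have \<psi>c: "\<psi> \<in> carrier (cocycle_group2 G A)" using assms by simp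
    have "push2 G h \<chi> = push2 G h b \<otimes>\<^bsub>cocycle_group2 G B\<^esub> push2 G h \<psi>"
      unfolding b(2) by (rule p.hom_mult[OF bc \<psi>c])
    then have "push2 G h \<chi> \<in> coboundaries2 G B #>\<^bsub>cocycle_group2 G B\<^esub> push2 G h \<psi>"
      using push2_coboundary[OF b(1)] unfolding r_coset_def by blast
    then show ?thesis
      using ZB.repr_independence[OF _ p.hom_closed[OF \<psi>c] B.subgroup_coboundaries2]
      unfolding class2_def by metis
  qed
  moreover have "\<psi> \<in> class2 G A \<psi>"
    unfolding class2_def
    by (rule ZA.rcos_self[OF _ A.subgroup_coboundaries2]) (use assms in simp)
  ultimately have "(\<lambda>\<chi>. class2 G B (push2 G h \<chi>)) ` class2 G A \<psi> = {class2 G B (push2 G h \<psi>)}"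
    by blast
  then show ?thesis unfolding H2_map_def by simp
qed

lemma carrier_H2_cases:
  assumes "X \<in> carrier (H2 G A)"
  obtains \<psi> where "\<psi> \<in> cocycles2 G A" "X = class2 G A \<psi>"
  using assms by (auto simp: H2_def carrier_FactGroup class2_def)

lemma H2_map_hom: "H2_map G B h \<in> hom (H2 G A) (H2 G B)"
proof (rule homI)
  interpret p: group_hom "cocycle_group2 G A" "cocycle_group2 G B" "push2 G h"
    using push2_hom A.comm_group_cocycle_group2 B.comm_group_cocycle_group2
    by (simp add: group_hom_def group_hom_axioms_def comm_group_def)
  {
    fix X assume "X \<in> carrier (H2 G A)"
    then obtain \<psi> where \<psi>: "\<psi> \<in> cocycles2 G A" "X = class2 G A \<psi>"
      by (rule carrier_H2_cases)
    then show "H2_map G B h X \<in> carrier (H2 G B)"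
      using p.hom_closed[of \<psi>] by (simp add: H2_map_class2) (simp add: H2_def carrier_FactGroup class2_def)
  }
  fix X Y assume X: "X \<in> carrier (H2 G A)" and Y: "Y \<in> carrier (H2 G A)"
  from X obtain \<psi> where \<psi>: "\<psi> \<in> cocycles2 G A" "X = class2 G A \<psi>"
    by (rule carrier_H2_cases)
  from Y obtain \<chi> where \<chi>: "\<chi> \<in> cocycles2 G A" "Y = class2 G A \<chi>"
    by (rule carrier_H2_cases)
  have \<psi>c: "\<psi> \<in> carrier (cocycle_group2 G A)" and \<chi>c: "\<chi> \<in> carrier (cocycle_group2 G A)"
    using \<psi>(1) \<chi>(1) by simp_all
  have prod: "\<psi> \<otimes>\<^bsub>cocycle_group2 G A\<^esub> \<chi> \<in> cocycles2 G A"
    using p.G.m_closed[OF \<psi>c \<chi>c] by simp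
  have "H2_map G B h (X \<otimes>\<^bsub>H2 G A\<^esub> Y)
      = H2_map G B h (class2 G A (\<psi> \<otimes>\<^bsub>cocycle_group2 G A\<^esub> \<chi>))"
    unfolding \<psi>(2) \<chi>(2) class2_def H2_def mult_FactGroup
    by (simp only: normal.rcos_sum[OF A.normal_coboundaries2 \<psi>c \<chi>c])
  also have "\<dots> = class2 G B (push2 G h \<psi> \<otimes>\<^bsub>cocycle_group2 G B\<^esub> push2 G h \<chi>)"
    by (simp only: H2_map_class2[OF prod] p.hom_mult[OF \<psi>c \<chi>c])
  also have "\<dots> = H2_map G B h X \<otimes>\<^bsub>H2 G B\<^esub> H2_map G B h Y"
    unfolding \<psi>(2) \<chi>(2) H2_map_class2[OF \<psi>(1)] H2_map_class2[OF \<chi>(1)]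
    unfolding class2_def H2_def mult_FactGroup
    by (simp only: normal.rcos_sum[OF B.normal_coboundaries2 p.hom_closed[OF \<psi>c] p.hom_closed[OF \<chi>c]])
  finally show "H2_map G B h (X \<otimes>\<^bsub>H2 G A\<^esub> Y) = H2_map G B h X \<otimes>\<^bsub>H2 G B\<^esub> H2_map G B h Y" .
qed

end

lemma H2_map_id:
  assumes "trivial_coeff G A" "X \<in> carrier (H2 G A)"
  shows "H2_map G A (\<lambda>x. x) X = X"
proof -
  interpret trivial_coeff G A by fact
  have h: "coeff_hom G A A (\<lambda>x. x)"
    using assms(1) by (simp add: coeff_hom_def coeff_hom_axioms_def hom_def)
  obtain \<psi> where \<psi>: "\<psi> \<in> cocycles2 G A" "X = class2 G A \<psi>"
    using assms(2) by (rule coeff_hom.carrier_H2_cases[OF h])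
  have "push2 G (\<lambda>x. x) \<psi> = \<psi>"
    unfolding push2_def using \<psi>(1)
    by (intro PiE_restrict[where B = "\<lambda>_. carrier A"]) (simp add: cocycles2_def cochains2_def)
  then show ?thesis using \<psi> by (simp add: coeff_hom.H2_map_class2[OF h])
qed

lemma H2_map_comp:
  assumes "coeff_hom G A B h" "coeff_hom G B C k" "X \<in> carrier (H2 G A)"
  shows "H2_map G C k (H2_map G B h X) = H2_map G C (\<lambda>x. k (h x)) X"
proof -
  interpret h: coeff_hom G A B h by fact
  interpret k: coeff_hom G B C k by fact
  have "(\<lambda>x. k (h x)) \<in> hom A C"
    using hom_compose[OF h.hom k.hom] by (simp add: comp_def)
  then interpret kh: coeff_hom G A C "\<lambda>x. k (h x)" by unfold_locales
  obtain \<psi> where \<psi>: "\<psi> \<in> cocycles2 G A" "X = class2 G A \<psi>"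
    using assms(3) by (rule h.carrier_H2_cases)
  have "push2 G h \<psi> \<in> cocycles2 G B"
    using h.push2_hom \<psi>(1) by (auto simp: hom_def)
  moreover have "push2 G k (push2 G h \<psi>) = push2 G (\<lambda>x. k (h x)) \<psi>"
    by (auto simp: push2_def)
  ultimately show ?thesis using \<psi> by (simp add: h.H2_map_class2 k.H2_map_class2 kh.H2_map_class2)
qed

lemma UN_pairs_constant_eq:
  assumes "(a, b) \<in> S" "\<And>x y. (x, y) \<in> S \<Longrightarrow> g x y = W"
  shows "(\<Union>(x, y)\<in>S. g x y) = W"
  using assms by fastforce

locale direct_system =
  fixes I :: "'i::order set" and D :: "'i \<Rightarrow> ('d, 'u) monoid_scheme" and f :: "'i \<Rightarrow> 'i \<Rightarrow> 'd \<Rightarrow> 'd"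
  assumes nonempty: "I \<noteq> {}"
    and directed: "\<lbrakk>i \<in> I; j \<in> I\<rbrakk> \<Longrightarrow> \<exists>k\<in>I. i \<le> k \<and> j \<le> k"
    and grp: "i \<in> I \<Longrightarrow> group (D i)"
    and hom: "\<lbrakk>i \<in> I; j \<in> I; i \<le> j\<rbrakk> \<Longrightarrow> f i j \<in> hom (D i) (D j)"
    and f_id: "\<lbrakk>i \<in> I; x \<in> carrier (D i)\<rbrakk> \<Longrightarrow> f i i x = x"
    and f_comp: "\<lbrakk>i \<in> I; j \<in> I; k \<in> I; i \<le> j; j \<le> k; x \<in> carrier (D i)\<rbrakk> \<Longrightarrow> f j k (f i j x) = f i k x"
begin

abbreviation "R \<equiv> dlim_rel I D f"
abbreviation "cls i x \<equiv> R `` {(i, x)}"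

lemma f_closed: "\<lbrakk>i \<in> I; j \<in> I; i \<le> j; x \<in> carrier (D i)\<rbrakk> \<Longrightarrow> f i j x \<in> carrier (D j)"
  by (rule hom_in_carrier[OF hom])

lemma f_mult: "\<lbrakk>i \<in> I; j \<in> I; i \<le> j; x \<in> carrier (D i); y \<in> carrier (D i)\<rbrakk> \<Longrightarrow>
    f i j (x \<otimes>\<^bsub>D i\<^esub> y) = f i j x \<otimes>\<^bsub>D j\<^esub> f i j y"
  by (rule hom_mult[OF hom])

lemma f_one: "\<lbrakk>i \<in> I; j \<in> I; i \<le> j\<rbrakk> \<Longrightarrow> f i j \<one>\<^bsub>D i\<^esub> = \<one>\<^bsub>D j\<^esub>"
  by (rule hom_one[OF hom grp grp])

lemma RI: "\<lbrakk>i \<in> I; j \<in> I; k \<in> I; x \<in> carrier (D i); y \<in> carrier (D j); i \<le> k; j \<le> k;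
    f i k x = f j k y\<rbrakk> \<Longrightarrow> ((i, x), (j, y)) \<in> R"
  unfolding dlim_rel_def by blast

lemma equiv_R: "equiv (SIGMA i:I. carrier (D i)) R"
proof (rule equivI)
  show "R \<subseteq> (SIGMA i:I. carrier (D i)) \<times> (SIGMA i:I. carrier (D i))"
    by (auto simp: dlim_rel_def)
  show "refl_on (SIGMA i:I. carrier (D i)) R"
    by (auto simp: dlim_rel_def refl_on_def)
  show "sym R"
  proof (rule symI)
    fix p q assume "(p, q) \<in> R"
    moreover obtain i x j y where [simp]: "p = (i, x)" "q = (j, y)"
      by (metis surj_pair)
    ultimately obtain k where k: "i \<in> I" "j \<in> I" "x \<in> carrier (D i)" "y \<in> carrier (D j)"
      "k \<in> I" "i \<le> k" "j \<le> k" "f i k x = f j k y"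
      by (auto simp: dlim_rel_def)
    have "((j, y), (i, x)) \<in> R"
      by (rule RI[OF k(2,1,5,4,3,7,6) k(8)[symmetric]])
    then show "(q, p) \<in> R" by simp
  qed
  show "trans R"
  proof (rule transI)
    fix p q r assume pq: "(p, q) \<in> R" and qr: "(q, r) \<in> R"
    obtain i x j y l z where [simp]: "p = (i, x)" "q = (j, y)" "r = (l, z)"
      by (metis surj_pair)
    from pq obtain k where k: "i \<in> I" "j \<in> I" "x \<in> carrier (D i)" "y \<in> carrier (D j)"
      "k \<in> I" "i \<le> k" "j \<le> k" "f i k x = f j k y"
      by (auto simp: dlim_rel_def)
    from qr obtain m where m: "l \<in> I" "z \<in> carrier (D l)" "m \<in> I" "j \<le> m" "l \<le> m" "f j m y = f l m z"
      by (auto simp: dlim_rel_def)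
    obtain n where n: "n \<in> I" "k \<le> n" "m \<le> n"
      using directed k(5) m(3) by blast
    have kn: "i \<le> n" "j \<le> n" "l \<le> n"
      by (rule order_trans[OF k(6) n(2)], rule order_trans[OF k(7) n(2)], rule order_trans[OF m(5) n(3)])
    have "f i n x = f k n (f i k x)" by (rule f_comp[symmetric]) (rule k n)+
    also have "\<dots> = f k n (f j k y)" by (simp only: k(8))
    also have "\<dots> = f j n y" by (rule f_comp) (rule k n)+
    also have "\<dots> = f m n (f j m y)" by (rule f_comp[symmetric]) (rule k m n)+
    also have "\<dots> = f m n (f l m z)" by (simp only: m(6))
    also have "\<dots> = f l n z" by (rule f_comp) (rule m n)+
    finally have "((i, x), (l, z)) \<in> R"
      by (rule RI[OF k(1) m(1) n(1) k(3) m(2) kn(1) kn(3)])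
    then show "(p, r) \<in> R" by simp
  qed
qed

lemma cls_eqI: "\<lbrakk>i \<in> I; j \<in> I; k \<in> I; x \<in> carrier (D i); y \<in> carrier (D j); i \<le> k; j \<le> k;
    f i k x = f j k y\<rbrakk> \<Longrightarrow> cls i x = cls j y"
  by (rule equiv_class_eq[OF equiv_R RI])

lemma cls_in: "\<lbrakk>i \<in> I; x \<in> carrier (D i)\<rbrakk> \<Longrightarrow> cls i x \<in> carrier (dlim I D f)"
  unfolding dlim_def partial_object.simps by (rule quotientI) simp

lemma dlim_cases:
  assumes "X \<in> carrier (dlim I D f)"
  obtains i x where "i \<in> I" "x \<in> carrier (D i)" "X = cls i x"
  using assms unfolding dlim_def partial_object.simps by (rule quotientE) blast

lemma cls_lift: "\<lbrakk>i \<in> I; k \<in> I; i \<le> k; x \<in> carrier (D i)\<rbrakk> \<Longrightarrow> cls i x = cls k (f i k x)"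
  by (rule cls_eqI[of _ _ k]) (auto simp: f_closed f_id)

lemma mult_cls:
  assumes "i \<in> I" "j \<in> I" "k \<in> I" "i \<le> k" "j \<le> k" "x \<in> carrier (D i)" "y \<in> carrier (D j)"
  shows "cls i x \<otimes>\<^bsub>dlim I D f\<^esub> cls j y = cls k (f i k x \<otimes>\<^bsub>D k\<^esub> f j k y)"
proof -
  have closed: "f a c u \<otimes>\<^bsub>D c\<^esub> f b c v \<in> carrier (D c)"
    if "a \<in> I" "b \<in> I" "c \<in> I" "a \<le> c" "b \<le> c" "u \<in> carrier (D a)" "v \<in> carrier (D b)" for a b c u v
    using that grp by (simp add: f_closed group.is_monoid monoid.m_closed)
  have ind: "cls m (f a m u \<otimes>\<^bsub>D m\<^esub> f b m v) = cls k (f i k x \<otimes>\<^bsub>D k\<^esub> f j k y)"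
    if u: "(a, u) \<in> cls i x" and v: "(b, v) \<in> cls j y" and m: "m \<in> I" "a \<le> m" "b \<le> m" for a b m u v
  proof -
    from u obtain p where p: "a \<in> I" "u \<in> carrier (D a)" "p \<in> I" "i \<le> p" "a \<le> p" "f i p x = f a p u"
      by (auto simp: dlim_rel_def)
    from v obtain q where q: "b \<in> I" "v \<in> carrier (D b)" "q \<in> I" "j \<le> q" "b \<le> q" "f j q y = f b q v"
      by (auto simp: dlim_rel_def)
    obtain s where s: "s \<in> I" "p \<le> s" "q \<le> s"
      using directed p q by blast
    obtain t where t: "t \<in> I" "k \<le> t" "m \<le> t"
      using directed assms m by blast
    obtain n where n: "n \<in> I" "s \<le> n" "t \<le> n"
      using directed s t by blast
    have le: "p \<le> n" "q \<le> n" "k \<le> n" "m \<le> n"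
      by (rule order_trans[OF s(2) n(2)], rule order_trans[OF s(3) n(2)],
          rule order_trans[OF t(2) n(3)], rule order_trans[OF t(3) n(3)])
    have "f i n x = f p n (f i p x)" by (rule f_comp[symmetric]) (rule assms p n le)+
    also have "\<dots> = f p n (f a p u)" by (simp only: p(6))
    also have "\<dots> = f a n u" by (rule f_comp) (rule p n le)+
    finally have e1: "f i n x = f a n u" .
    have "f j n y = f q n (f j q y)" by (rule f_comp[symmetric]) (rule assms q n le)+
    also have "\<dots> = f q n (f b q v)" by (simp only: q(6))
    also have "\<dots> = f b n v" by (rule f_comp) (rule q n le)+
    finally have e2: "f j n y = f b n v" .
    have "f m n (f a m u \<otimes>\<^bsub>D m\<^esub> f b m v) = f a n u \<otimes>\<^bsub>D n\<^esub> f b n v"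
      using m p(1,2) q(1,2) n(1) le by (simp add: f_mult f_comp f_closed)
    moreover have "f k n (f i k x \<otimes>\<^bsub>D k\<^esub> f j k y) = f i n x \<otimes>\<^bsub>D n\<^esub> f j n y"
      using assms n(1) le by (simp add: f_mult f_comp f_closed)
    ultimately have e: "f m n (f a m u \<otimes>\<^bsub>D m\<^esub> f b m v) = f k n (f i k x \<otimes>\<^bsub>D k\<^esub> f j k y)"
      by (simp only: e1 e2)
    show ?thesis
      by (rule cls_eqI[OF m(1) assms(3) n(1) closed[OF p(1) q(1) m(1-3) p(2) q(2)]
            closed[OF assms(1-7)] le(4) le(3) e])
  qed
  have self: "(i, x) \<in> cls i x" "(j, y) \<in> cls j y"
    using assms equiv_class_self[OF equiv_R] by auto
  let ?W = "cls k (f i k x \<otimes>\<^bsub>D k\<^esub> f j k y)"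
  have inner: "(\<Union>m\<in>{m\<in>I. a \<le> m \<and> b \<le> m}. cls m (f a m u \<otimes>\<^bsub>D m\<^esub> f b m v)) = ?W"
    if u: "(a, u) \<in> cls i x" and v: "(b, v) \<in> cls j y" for a u b v
  proof -
    have "a \<in> I" "b \<in> I" using u v by (auto simp: dlim_rel_def)
    then obtain m where "m \<in> {m\<in>I. a \<le> m \<and> b \<le> m}" using directed by blast
    moreover have "cls m (f a m u \<otimes>\<^bsub>D m\<^esub> f b m v) = ?W"
      if "m \<in> {m\<in>I. a \<le> m \<and> b \<le> m}" for m
      using ind[OF u v, of m] that by simp
    ultimately show ?thesis
      by (intro UN_constant_eq ballI)
  qed
  have middle: "(\<Union>(b, v)\<in>cls j y. \<Union>m\<in>{m\<in>I. a \<le> m \<and> b \<le> m}.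
      cls m (f a m u \<otimes>\<^bsub>D m\<^esub> f b m v)) = ?W" if u: "(a, u) \<in> cls i x" for a u
    by (rule UN_pairs_constant_eq[OF self(2) inner[OF u]])
  have "(\<Union>(a, u)\<in>cls i x. \<Union>(b, v)\<in>cls j y. \<Union>m\<in>{m\<in>I. a \<le> m \<and> b \<le> m}.
      cls m (f a m u \<otimes>\<^bsub>D m\<^esub> f b m v)) = ?W"
    by (rule UN_pairs_constant_eq[OF self(1) middle])
  then show ?thesis by (simp add: dlim_def del: UN_simps)
qed

lemma one_cls:
  assumes "i \<in> I"
  shows "\<one>\<^bsub>dlim I D f\<^esub> = cls i \<one>\<^bsub>D i\<^esub>"
proof -
  have "cls j \<one>\<^bsub>D j\<^esub> = cls i \<one>\<^bsub>D i\<^esub>" if j: "j \<in> I" for j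
  proof -
    obtain k where k: "k \<in> I" "i \<le> k" "j \<le> k" using directed[OF assms j] by blast
    have e: "f j k \<one>\<^bsub>D j\<^esub> = f i k \<one>\<^bsub>D i\<^esub>"
      by (simp only: f_one[OF j k(1,3)] f_one[OF assms k(1,2)])
    show ?thesis
      by (rule cls_eqI[OF j assms k(1) monoid.one_closed monoid.one_closed k(3,2) e])
        (simp_all add: group.is_monoid grp j assms)
  qed
  then have "(\<Union>j\<in>I. cls j \<one>\<^bsub>D j\<^esub>) = cls i \<one>\<^bsub>D i\<^esub>"
    by (intro UN_constant_eq[OF assms] ballI)
  then show ?thesis by (simp only: dlim_def monoid.select_convs)
qed

lemma dlim_cases2:
  assumes "X \<in> carrier (dlim I D f)" "Y \<in> carrier (dlim I D f)"
  obtains k x y where "k \<in> I" "x \<in> carrier (D k)" "y \<in> carrier (D k)" "X = cls k x" "Y = cls k y"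
proof -
  obtain i x where x: "i \<in> I" "x \<in> carrier (D i)" "X = cls i x"
    using assms(1) by (rule dlim_cases)
  obtain j y where y: "j \<in> I" "y \<in> carrier (D j)" "Y = cls j y"
    using assms(2) by (rule dlim_cases)
  obtain k where k: "k \<in> I" "i \<le> k" "j \<le> k" using directed[OF x(1) y(1)] by blast
  show ?thesis
    by (rule that[OF k(1) f_closed[OF x(1) k(1,2) x(2)] f_closed[OF y(1) k(1,3) y(2)]])
      (simp_all only: x(3) y(3) cls_lift[OF x(1) k(1,2) x(2)] cls_lift[OF y(1) k(1,3) y(2)])
qed

lemma mult_cls_same:
  assumes "k \<in> I" "x \<in> carrier (D k)" "y \<in> carrier (D k)"
  shows "cls k x \<otimes>\<^bsub>dlim I D f\<^esub> cls k y = cls k (x \<otimes>\<^bsub>D k\<^esub> y)"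
  using mult_cls[of k k k x y] assms by (simp add: f_id)

lemma group_dlim: "group (dlim I D f)"
proof (rule groupI)
  obtain i where i: "i \<in> I" using nonempty by blast
  show "\<one>\<^bsub>dlim I D f\<^esub> \<in> carrier (dlim I D f)"
    using i grp[OF i] by (simp add: one_cls cls_in group.is_monoid)
next
  fix X Y assume XY: "X \<in> carrier (dlim I D f)" "Y \<in> carrier (dlim I D f)"
  obtain k x y where k: "k \<in> I" "x \<in> carrier (D k)" "y \<in> carrier (D k)" "X = cls k x" "Y = cls k y"
    using XY by (rule dlim_cases2)
  interpret group "D k" using grp k(1) .
  show "X \<otimes>\<^bsub>dlim I D f\<^esub> Y \<in> carrier (dlim I D f)"
    using k by (simp add: mult_cls_same cls_in)
next
  fix X Y Z assume XYZ: "X \<in> carrier (dlim I D f)" "Y \<in> carrier (dlim I D f)" "Z \<in> carrier (dlim I D f)"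
  obtain k x y where k: "k \<in> I" "x \<in> carrier (D k)" "y \<in> carrier (D k)" "X = cls k x" "Y = cls k y"
    using XYZ(1,2) by (rule dlim_cases2)
  obtain l z where l: "l \<in> I" "z \<in> carrier (D l)" "Z = cls l z"
    using XYZ(3) by (rule dlim_cases)
  obtain n where n: "n \<in> I" "k \<le> n" "l \<le> n" using directed[OF k(1) l(1)] by blast
  interpret group "D n" using grp n(1) .
  have "X = cls n (f k n x)" "Y = cls n (f k n y)" "Z = cls n (f l n z)"
    by (simp_all only: k(4,5) l(3) cls_lift[OF k(1) n(1,2) k(2)] cls_lift[OF k(1) n(1,2) k(3)]
        cls_lift[OF l(1) n(1,3) l(2)])
  then show "X \<otimes>\<^bsub>dlim I D f\<^esub> Y \<otimes>\<^bsub>dlim I D f\<^esub> Z = X \<otimes>\<^bsub>dlim I D f\<^esub> (Y \<otimes>\<^bsub>dlim I D f\<^esub> Z)"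
    using k l n by (simp add: mult_cls_same f_closed m_assoc)
next
  fix X assume X: "X \<in> carrier (dlim I D f)"
  obtain i x where i: "i \<in> I" "x \<in> carrier (D i)" "X = cls i x"
    using X by (rule dlim_cases)
  interpret group "D i" using grp i(1) .
  show "\<one>\<^bsub>dlim I D f\<^esub> \<otimes>\<^bsub>dlim I D f\<^esub> X = X"
    using i by (simp add: one_cls[OF i(1)] mult_cls_same)
  have "cls i (inv\<^bsub>D i\<^esub> x) \<otimes>\<^bsub>dlim I D f\<^esub> X = \<one>\<^bsub>dlim I D f\<^esub>"
    using i by (simp add: one_cls[OF i(1)] mult_cls_same)
  then show "\<exists>Y\<in>carrier (dlim I D f). Y \<otimes>\<^bsub>dlim I D f\<^esub> X = \<one>\<^bsub>dlim I D f\<^esub>"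
    using i cls_in by (intro bexI[of _ "cls i (inv\<^bsub>D i\<^esub> x)"]) auto
qed

context
  fixes h :: "'i \<Rightarrow> 'd \<Rightarrow> 'e" and K :: "('e, 'v) monoid_scheme"
  assumes h_hom: "\<And>i. i \<in> I \<Longrightarrow> h i \<in> hom (D i) K"
    and h_compat: "\<And>i j x. \<lbrakk>i \<in> I; j \<in> I; i \<le> j; x \<in> carrier (D i)\<rbrakk> \<Longrightarrow> h j (f i j x) = h i x"
begin

lemma dlim_map_cls:
  assumes "i \<in> I" "x \<in> carrier (D i)"
  shows "dlim_map h (cls i x) = h i x"
proof -
  have eq: "h j y = h i x" if "(j, y) \<in> cls i x" for j y
  proof -
    from that obtain k where k: "j \<in> I" "y \<in> carrier (D j)" "k \<in> I" "i \<le> k" "j \<le> k" "f i k x = f j k y"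
      by (auto simp: dlim_rel_def)
    have eq: "h j y = h k (f j k y)" by (rule h_compat[symmetric, OF k(1,3,5,2)])
    also have "\<dots> = h k (f i k x)" by (simp only: k(6))
    also have "\<dots> = h i x" by (rule h_compat[OF assms(1) k(3,4) assms(2)])
    finally show ?thesis .
  qed
  have self: "(i, x) \<in> cls i x"
    using assms equiv_class_self[OF equiv_R] by auto
  have c: "(case p of (j, y) \<Rightarrow> h j y) = (case (i, x) of (j, y) \<Rightarrow> h j y)" if "p \<in> cls i x" for p
    using that eq[of "fst p" "snd p"] by (simp add: split_beta)
  have "the_elem ((\<lambda>(j, y). h j y) ` cls i x) = (case (i, x) of (j, y) \<Rightarrow> h j y)"
    by (rule the_elem_image_unique[OF _ c]) (use self in blast)
  then show ?thesis by (simp only: dlim_map_def prod.case)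
qed

lemma dlim_map_hom: "dlim_map h \<in> hom (dlim I D f) K"
proof (rule homI)
  fix X assume X: "X \<in> carrier (dlim I D f)"
  obtain i x where i: "i \<in> I" "x \<in> carrier (D i)" "X = cls i x"
    using X by (rule dlim_cases)
  then show "dlim_map h X \<in> carrier K"
    using h_hom by (auto simp: dlim_map_cls hom_def)
next
  fix X Y assume XY: "X \<in> carrier (dlim I D f)" "Y \<in> carrier (dlim I D f)"
  obtain k x y where k: "k \<in> I" "x \<in> carrier (D k)" "y \<in> carrier (D k)" "X = cls k x" "Y = cls k y"
    using XY by (rule dlim_cases2)
  interpret group "D k" using grp k(1) .
  show "dlim_map h (X \<otimes>\<^bsub>dlim I D f\<^esub> Y) = dlim_map h X \<otimes>\<^bsub>K\<^esub> dlim_map h Y"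
    using k h_hom[OF k(1)] by (simp add: mult_cls_same dlim_map_cls hom_def)
qed

end

end

lemma coeff_hom_free_incl:
  assumes "group G" "S \<subseteq> T"
  shows "coeff_hom G (free_Abelian_group S) (free_Abelian_group T) (\<lambda>x. x)"
  using assms abelian_free_Abelian_group[of S] abelian_free_Abelian_group[of T]
  by (auto simp: coeff_hom_def trivial_coeff_def coeff_hom_axioms_def hom_def)

lemma direct_system_H2_ZZ:
  assumes "group G"
  shows "direct_system {1..} (\<lambda>m. H2 G (ZZ m)) (\<lambda>m n. H2_map G (ZZ n) (\<lambda>x. x))"
proof (rule direct_system.intro)
  fix i j k :: nat and X
  have tc: "trivial_coeff G (ZZ n)" for n
    using coeff_hom_free_incl[OF assms, of "{..<n}" "{..<n}"] by (simp add: coeff_hom_def)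
  show "group (H2 G (ZZ i))"
    using trivial_coeff.comm_group_H2[OF tc] by (simp add: comm_group_def)
  show "H2_map G (ZZ i) (\<lambda>x. x) X = X" if "X \<in> carrier (H2 G (ZZ i))"
    using H2_map_id[OF tc that] .
  assume le: "i \<le> j"
  then have ij: "coeff_hom G (ZZ i) (ZZ j) (\<lambda>x. x)"
    by (intro coeff_hom_free_incl[OF assms]) auto
  show "H2_map G (ZZ j) (\<lambda>x. x) \<in> hom (H2 G (ZZ i)) (H2 G (ZZ j))"
    using coeff_hom.H2_map_hom[OF ij] .
  assume "j \<le> k" and X: "X \<in> carrier (H2 G (ZZ i))"
  then have "coeff_hom G (ZZ j) (ZZ k) (\<lambda>x. x)"
    by (intro coeff_hom_free_incl[OF assms]) auto
  from H2_map_comp[OF ij this X]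
  show "H2_map G (ZZ k) (\<lambda>x. x) (H2_map G (ZZ j) (\<lambda>x. x) X) = H2_map G (ZZ k) (\<lambda>x. x) X" .
next
  fix i j :: nat assume "i \<in> {1..}" "j \<in> {1..}"
  then show "\<exists>k\<in>{1..}. i \<le> k \<and> j \<le> k" by (intro bexI[of _ "max i j"]) auto
qed auto

lemma group_H2_ZZ_dlim: "group G \<Longrightarrow> group (H2_ZZ_dlim G)"
  by (rule direct_system.group_dlim[OF direct_system_H2_ZZ])

lemma H2_ZZ_dlim_map_compat:
  assumes "group G" "i \<le> j" "X \<in> carrier (H2 G (ZZ i))"
  shows "H2_map G ZZ_inf (\<lambda>x. x) (H2_map G (ZZ j) (\<lambda>x. x) X) = H2_map G ZZ_inf (\<lambda>x. x) X"
  using H2_map_comp[OF coeff_hom_free_incl coeff_hom_free_incl assms(3), of "{..<j}" UNIV] assms by auto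

lemma H2_ZZ_incl_hom:
  assumes "group G"
  shows "H2_map G ZZ_inf (\<lambda>x. x) \<in> hom (H2 G (ZZ m)) (H2 G ZZ_inf)"
  by (rule coeff_hom.H2_map_hom[OF coeff_hom_free_incl[OF assms]]) simp

lemma H2_ZZ_dlim_map_cls:
  assumes "group G" "1 \<le> m" "X \<in> carrier (H2 G (ZZ m))"
  shows "H2_ZZ_dlim_map G
      (dlim_rel {1..} (\<lambda>m. H2 G (ZZ m)) (\<lambda>m n. H2_map G (ZZ n) (\<lambda>x. x)) `` {(m, X)})
    = H2_map G ZZ_inf (\<lambda>x. x) X"
  by (rule direct_system.dlim_map_cls[OF direct_system_H2_ZZ[OF assms(1)]
        H2_ZZ_incl_hom[OF assms(1)] H2_ZZ_dlim_map_compat[OF assms(1)]])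
     (use assms in simp_all)

lemma H2_ZZ_dlim_map_hom:
  assumes "group G"
  shows "H2_ZZ_dlim_map G \<in> hom (H2_ZZ_dlim G) (H2 G ZZ_inf)"
  by (rule direct_system.dlim_map_hom[OF direct_system_H2_ZZ[OF assms]
        H2_ZZ_incl_hom[OF assms] H2_ZZ_dlim_map_compat[OF assms]])

end

theory Submission
  imports Defs
begin

text \<open>
  A finitely generated group is countable, hence exhausted by an increasing sequence of finite
  sets \<open>F 0 \<subseteq> F 1 \<subseteq> \<dots>\<close>.  Choose for every \<open>n\<close> an integral cocycle \<open>\<psi> n\<close> that is not a coboundary
  and vanishes on \<open>F n \<times> F n\<close>.  Every pair of group elements lies in \<open>F n \<times> F n\<close> from some \<open>n\<close> on,
  so only finitely many of the \<open>\<psi> n\<close> are nonzero at it, and the \<open>\<psi> n\<close> are the coordinates of one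
  cocycle \<open>\<Psi>\<close> with values in the countable direct sum (\<open>cocycle_from_coordinates\<close>).

  A class in the image of the direct limit comes from some stage \<open>m\<close> (\<open>H2_ZZ_dlim_image\<close>), and
  there the coordinate with index \<open>m\<close> vanishes.  So the coordinate \<open>m\<close> of every cocycle in such a
  class is a coboundary (\<open>coordinate_coboundary_of_stage\<close>).  For \<open>\<Psi>\<close> this coordinate is
  \<open>\<psi> m\<close>, which is not a coboundary; hence the class of \<open>\<Psi>\<close> is not in the image.
\<close>

lemma (in group) countable_generate:
  assumes S: "S \<subseteq> carrier G" and "countable S"
  shows "countable (generate G S)"
proof -
  let ?T = "S \<union> (\<lambda>x. inv x) ` S"
  let ?word = "\<lambda>xs. foldr (\<otimes>) xs \<one>"
  have T: "?T \<subseteq> carrier G" using S by auto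
  have closed: "?word xs \<in> carrier G" if "xs \<in> lists ?T" for xs
    using that T by (induction xs) auto
  have append: "?word (xs @ ys) = ?word xs \<otimes> ?word ys"
    if "xs \<in> lists ?T" "ys \<in> lists ?T" for xs ys
    using that(1)
  proof (induction xs)
    case Nil
    then show ?case using closed[OF that(2)] by simp
  next
    case (Cons x xs)
    then show ?case using closed[OF Cons.hyps(2)] closed[OF that(2)] T by (auto simp: m_assoc)
  qed
  have "x \<in> ?word ` lists ?T" if "x \<in> generate G S" for x
    using that
  proof (induction x rule: generate.induct)
    case one
    show ?case by (rule image_eqI[of _ _ "[]"]) auto
  next
    case (incl h)
    then show ?case using S by (intro image_eqI[of _ _ "[h]"]) auto
  next
    case (inv h)
    then show ?case using S by (intro image_eqI[of _ _ "[inv h]"]) auto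
  next
    case (eng h1 h2)
    then obtain xs ys where "xs \<in> lists ?T" "ys \<in> lists ?T" "h1 = ?word xs" "h2 = ?word ys"
      by blast
    then show ?case by (intro image_eqI[of _ _ "xs @ ys"]) (simp_all only: append append_in_lists_conv)
  qed
  then have "generate G S \<subseteq> ?word ` lists ?T" by blast
  moreover have "countable (?word ` lists ?T)" using \<open>countable S\<close> by simp
  ultimately show ?thesis by (rule countable_subset)
qed

lemma coeff_hom_coordinate:
  assumes "group G"
  shows "coeff_hom G (free_Abelian_group S) integer_group (\<lambda>x. Poly_Mapping.lookup x i)"
  using assms abelian_free_Abelian_group[of S] abelian_integer_group
  by (auto simp: coeff_hom_def trivial_coeff_def coeff_hom_axioms_def hom_def lookup_add)

text \<open>Finitely supported families are added coordinatewise, so the cocycle identity holds for the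
  assembled cochain as soon as it holds in each coordinate; pointwise finiteness of the support is
  what makes the values elements of the direct sum.\<close>

lemma cocycle_from_coordinates:
  fixes \<psi> :: "'i \<Rightarrow> 'g \<times> 'g \<Rightarrow> int"
  assumes "group G"
    and \<psi>: "\<And>i. \<psi> i \<in> cocycles2 G integer_group"
    and fin: "\<And>p. p \<in> carrier G \<times> carrier G \<Longrightarrow> finite {i. \<psi> i p \<noteq> 0}"
  obtains \<Psi> where "\<Psi> \<in> cocycles2 G (free_Abelian_group UNIV)"
    and "\<And>i. push2 G (\<lambda>x. Poly_Mapping.lookup x i) \<Psi> = \<psi> i"
proof -
  interpret group G by fact
  define \<Psi> where "\<Psi> = (\<lambda>p\<in>carrier G \<times> carrier G. Abs_poly_mapping (\<lambda>i. \<psi> i p))"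
  have coord: "Poly_Mapping.lookup (\<Psi> p) i = \<psi> i p" if "p \<in> carrier G \<times> carrier G" for p i
    using that fin[OF that] by (simp add: \<Psi>_def)
  have "\<Psi> (g2, g3) + - \<Psi> (g1 \<otimes>\<^bsub>G\<^esub> g2, g3) + \<Psi> (g1, g2 \<otimes>\<^bsub>G\<^esub> g3) + - \<Psi> (g1, g2) = 0"
    if "g1 \<in> carrier G" "g2 \<in> carrier G" "g3 \<in> carrier G" for g1 g2 g3
  proof (rule poly_mapping_eqI)
    fix i
    have "\<psi> i (g2, g3) + - \<psi> i (g1 \<otimes>\<^bsub>G\<^esub> g2, g3) + \<psi> i (g1, g2 \<otimes>\<^bsub>G\<^esub> g3) + - \<psi> i (g1, g2) = 0"
      using \<psi>[of i] that by (simp add: cocycles2_def)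
    then show "Poly_Mapping.lookup (\<Psi> (g2, g3) + - \<Psi> (g1 \<otimes>\<^bsub>G\<^esub> g2, g3) + \<Psi> (g1, g2 \<otimes>\<^bsub>G\<^esub> g3)
        + - \<Psi> (g1, g2)) i = Poly_Mapping.lookup 0 i"
      using that by (simp add: lookup_add lookup_minus coord)
  qed
  then have cocycle: "\<Psi> \<in> cocycles2 G (free_Abelian_group UNIV)"
    by (simp add: cocycles2_def cochains2_def) (simp add: \<Psi>_def)
  have coordinates: "push2 G (\<lambda>x. Poly_Mapping.lookup x i) \<Psi> = \<psi> i" for i
  proof
    fix p
    show "push2 G (\<lambda>x. Poly_Mapping.lookup x i) \<Psi> p = \<psi> i p"
    proof (cases "p \<in> carrier G \<times> carrier G")
      case True
      then show ?thesis by (simp add: push2_def coord)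
    next
      case False
      have "\<psi> i \<in> extensional (carrier G \<times> carrier G)"
        using \<psi>[of i] by (simp add: cocycles2_def cochains2_def PiE_def)
      then have "\<psi> i p = undefined" using False by (rule extensional_arb)
      then show ?thesis unfolding push2_def using False by (simp only: restrict_apply if_False)
    qed
  qed
  show ?thesis using cocycle coordinates by (rule that)
qed

lemma H2_ZZ_dlim_image:
  assumes "group G" "Z \<in> H2_ZZ_dlim_map G ` carrier (H2_ZZ_dlim G)"
  obtains m \<chi> where "\<chi> \<in> cocycles2 G (ZZ m)" "Z = class2 G ZZ_inf (push2 G (\<lambda>x. x) \<chi>)"
proof -
  from assms(2) obtain X where X: "X \<in> carrier (H2_ZZ_dlim G)" and Z: "Z = H2_ZZ_dlim_map G X"
    by blast
  obtain m Y where m: "m \<in> {1..}" and Y: "Y \<in> carrier (H2 G (ZZ m))"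
    and XY: "X = dlim_rel {1..} (\<lambda>m. H2 G (ZZ m)) (\<lambda>m n. H2_map G (ZZ n) (\<lambda>x. x)) `` {(m, Y)}"
    using X by (rule direct_system.dlim_cases[OF direct_system_H2_ZZ[OF assms(1)]])
  interpret coeff_hom G "ZZ m" ZZ_inf "\<lambda>x. x"
    by (rule coeff_hom_free_incl[OF assms(1)]) simp
  obtain \<chi> where \<chi>: "\<chi> \<in> cocycles2 G (ZZ m)" "Y = class2 G (ZZ m) \<chi>"
    using Y by (rule carrier_H2_cases)
  have "Z = H2_map G ZZ_inf (\<lambda>x. x) Y"
    unfolding Z XY using m by (intro H2_ZZ_dlim_map_cls[OF assms(1) _ Y]) simp
  then have "Z = class2 G ZZ_inf (push2 G (\<lambda>x. x) \<chi>)"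
    by (simp only: \<chi>(2) H2_map_class2[OF \<chi>(1)])
  with \<chi>(1) show ?thesis by (rule that)
qed

text \<open>A cocycle \<open>\<Psi>\<close> cohomologous to \<open>\<chi>\<close> differs from it by a coboundary; the coordinate with
  index \<open>i\<close> maps this coboundary to an integral one and kills \<open>\<chi>\<close>, whose values have
  support in \<open>S\<close>.\<close>

lemma coordinate_coboundary_of_stage:
  fixes i :: 'i
  assumes "group G" and \<chi>: "\<chi> \<in> cocycles2 G (free_Abelian_group S)" and "i \<notin> S"
    and \<Psi>: "\<Psi> \<in> cocycles2 G (free_Abelian_group UNIV)"
    and eq: "class2 G (free_Abelian_group UNIV) \<Psi>
      = class2 G (free_Abelian_group UNIV) (push2 G (\<lambda>x. x) \<chi>)"
  shows "push2 G (\<lambda>x. Poly_Mapping.lookup x i) \<Psi> \<in> coboundaries2 G integer_group"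
proof -
  let ?A = "free_Abelian_group (UNIV :: 'i set)"
  let ?c = "push2 G (\<lambda>x. Poly_Mapping.lookup x i)"
  interpret incl: coeff_hom G "free_Abelian_group S" ?A "\<lambda>x. x"
    by (rule coeff_hom_free_incl[OF assms(1)]) simp
  interpret coord: coeff_hom G ?A integer_group "\<lambda>x. Poly_Mapping.lookup x i"
    by (rule coeff_hom_coordinate[OF assms(1)])
  interpret Z: comm_group "cocycle_group2 G ?A" by (rule incl.B.comm_group_cocycle_group2)
  have "\<Psi> \<in> class2 G ?A \<Psi>"
    unfolding class2_def
    by (rule Z.rcos_self[OF _ incl.B.subgroup_coboundaries2]) (use \<Psi> in simp)
  then obtain b where b: "b \<in> coboundaries2 G ?A"
    and \<Psi>b: "\<Psi> = b \<otimes>\<^bsub>cocycle_group2 G ?A\<^esub> push2 G (\<lambda>x. x) \<chi>"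
    unfolding eq by (auto simp: class2_def r_coset_def)
  have "Poly_Mapping.lookup (\<chi> p) i = 0" if "p \<in> carrier G \<times> carrier G" for p
  proof -
    have "Poly_Mapping.keys (\<chi> p) \<subseteq> S"
      using \<chi> that unfolding cocycles2_def cochains2_def
      by (metis (no_types, lifting) PiE_mem carrier_free_Abelian_group_iff carrier_product_group
          mem_Collect_eq)
    then show ?thesis using \<open>i \<notin> S\<close> by (auto simp: in_keys_iff)
  qed
  then have "?c \<Psi> = ?c b"
    by (auto simp: \<Psi>b push2_def cochains2_def lookup_add fun_eq_iff)
  then show ?thesis using coord.push2_coboundary[OF b] by simp
qed

theorem proposition5p7:
  fixes \<Gamma> :: "('g, 'u) monoid_scheme"
  assumes "group \<Gamma>"
    and "\<exists>S. finite S \<and> S \<subseteq> carrier \<Gamma> \<and> generate \<Gamma> S = carrier \<Gamma>"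
    and "\<And>F. \<lbrakk>finite F; F \<subseteq> carrier \<Gamma>\<rbrakk> \<Longrightarrow>
      \<exists>\<psi> \<in> cocycles2 \<Gamma> integer_group. \<psi> \<notin> coboundaries2 \<Gamma> integer_group \<and> (\<forall>p \<in> F \<times> F. \<psi> p = 0)"
  shows "H2_ZZ_dlim_map \<Gamma> ` carrier (H2_ZZ_dlim \<Gamma>) \<noteq> carrier (H2 \<Gamma> ZZ_inf)"
proof
  assume surj: "H2_ZZ_dlim_map \<Gamma> ` carrier (H2_ZZ_dlim \<Gamma>) = carrier (H2 \<Gamma> ZZ_inf)"
  interpret group \<Gamma> by fact
  have "countable (carrier \<Gamma>)"
    using assms(2) countable_generate countable_finite by metis
  moreover have "carrier \<Gamma> \<noteq> {}" by blast
  ultimately have range: "range (from_nat_into (carrier \<Gamma>)) = carrier \<Gamma>"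
    by (intro range_from_nat_into)
  define F where "F n = from_nat_into (carrier \<Gamma>) ` {..n}" for n
  have "\<exists>\<psi> \<in> cocycles2 \<Gamma> integer_group. \<psi> \<notin> coboundaries2 \<Gamma> integer_group
      \<and> (\<forall>p \<in> F n \<times> F n. \<psi> p = 0)" for n
    using range by (intro assms(3)) (auto simp: F_def)
  then obtain \<psi> where \<psi>: "\<psi> n \<in> cocycles2 \<Gamma> integer_group"
      "\<psi> n \<notin> coboundaries2 \<Gamma> integer_group" "\<And>p. p \<in> F n \<times> F n \<Longrightarrow> \<psi> n p = 0" for n
    by metis
  have fin: "finite {n. \<psi> n p \<noteq> 0}" if p: "p \<in> carrier \<Gamma> \<times> carrier \<Gamma>" for p
  proof -
    have "fst p \<in> range (from_nat_into (carrier \<Gamma>))" "snd p \<in> range (from_nat_into (carrier \<Gamma>))"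
      unfolding range using p by auto
    then obtain j k where "fst p = from_nat_into (carrier \<Gamma>) j" "snd p = from_nat_into (carrier \<Gamma>) k"
      by blast
    then have jk: "p = (from_nat_into (carrier \<Gamma>) j, from_nat_into (carrier \<Gamma>) k)"
      by (simp add: prod_eq_iff)
    have "\<psi> n p = 0" if "max j k \<le> n" for n
      using that by (intro \<psi>(3)) (auto simp: F_def jk)
    then have "{n. \<psi> n p \<noteq> 0} \<subseteq> {..<max j k}"
      by (metis (mono_tags, lifting) lessThan_iff mem_Collect_eq not_le subsetI)
    then show ?thesis by (rule finite_subset) simp
  qed
  obtain \<Psi> where \<Psi>: "\<Psi> \<in> cocycles2 \<Gamma> ZZ_inf"
    and coord: "\<And>n. push2 \<Gamma> (\<lambda>x. Poly_Mapping.lookup x n) \<Psi> = \<psi> n"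
    by (rule cocycle_from_coordinates[OF assms(1) \<psi>(1) fin]) (assumption, rule that)
  have "class2 \<Gamma> ZZ_inf \<Psi> \<in> carrier (H2 \<Gamma> ZZ_inf)"
    using \<Psi> by (auto simp: H2_def class2_def carrier_FactGroup)
  then have "class2 \<Gamma> ZZ_inf \<Psi> \<in> H2_ZZ_dlim_map \<Gamma> ` carrier (H2_ZZ_dlim \<Gamma>)"
    by (simp only: surj)
  then obtain m \<chi> where "\<chi> \<in> cocycles2 \<Gamma> (ZZ m)"
    and "class2 \<Gamma> ZZ_inf \<Psi> = class2 \<Gamma> ZZ_inf (push2 \<Gamma> (\<lambda>x. x) \<chi>)"
    by (rule H2_ZZ_dlim_image[OF assms(1)])
  then have "push2 \<Gamma> (\<lambda>x. Poly_Mapping.lookup x m) \<Psi> \<in> coboundaries2 \<Gamma> integer_group"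
    \<comment> \<open>the coordinates of \<open>ZZ m\<close> are \<open>0, \<dots>, m - 1\<close>, so \<open>m\<close> is the first one beyond them\<close>
    by (intro coordinate_coboundary_of_stage[OF assms(1) _ _ \<Psi>]) auto
  then show False using \<psi>(2) by (simp only: coord)
qed

end
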